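(* There are non-regular Landsberg spaces which are not Berwaldian. That is, there exist a smooth manifold $M$ and a non-regular Finsler function $F$ on $M$ whose Landsberg tensor $L_{ijk}$ vanishes identically but which is not Berwaldian, i.e. whose Chern hv-curvature $\overset{*}{P}$ (equivalently, since $L_{ijk}=0$, whose Berwald tensor $G^h_{ijk}$) does not vanish identically.
   Context: Let $(x^i)$ be local coordinates on $M$ and $(x^i,y^i)$ the induced coordinates on $TM$. A non-regular Finsler function on $M$ means a positive smooth function $F$ defined on an open conic subset $U$ (invariant under $y\mapsto\lambda y$, $\lambda>0$) of the bundle of nonzero tangent vectors, which is positively homogeneous of degree 1 in $y$, such that the matrix $g_{ij}=\frac12\frac{\partial^2F^2}{\partial y^i\partial y^j}$ is nondegenerate on $U$, and which does not extend to a Finsler function that is smooth on the whole bundle of nonzero tangent vectors (i.e. it has singularities). Spray coefficients: $G^h=\frac14g^{hl}\left(\frac{\partial^2F^2}{\partial x^k\partial y^l}y^k-\frac{\partial F^2}{\partial x^l}\right)$. Berwald tensor: $G^h_{ijk}=\frac{\partial^3G^h}{\partial y^i\partial y^j\partial y^k}$. Landsberg tensor: $L_{ijk}=\frac F2\frac{\partial F}{\partial y^h}G^h_{ijk}$. The space is Landsbergian if $L_{ijk}=0$, and Berwaldian if the hv-curvature $\overset{*}{P}$ of the Chern connection vanishes, where in components $\overset{*}{P}{}^i_{hjk}=\pm\frac{\partial \overset{*}{\Gamma}{}^i_{hj}}{\partial y^k}$ with $\overset{*}{\Gamma}{}^i_{hj}=\frac12g^{il}(\delta_hg_{lj}+\delta_jg_{hl}-\delta_lg_{hj})$,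 $\delta_j=\frac{\partial}{\partial x^j}-N^m_j\frac{\partial}{\partial y^m}$, $N^m_j=\frac{\partial G^m}{\partial y^j}$; being Berwaldian is equivalent to $G^h_{ijk}=0$. *)

theory Defs
  imports
    "HOL-Analysis.Derivative"
    "HOL-Analysis.Abstract_Euclidean_Space"
    "Jordan_Normal_Form.Determinant"
    "Jordan_Normal_Form.Gauss_Jordan_Elimination"
begin

section \<open>Partial derivatives and smooth functions on open subsets of R^m\<close>

text \<open>
  Points of R^m are sequences with support in the first m indices, i.e. the points of
  the library's \<open>Euclidean_space m\<close>; the coordinates are numbered from 0.
\<close>

definition pd :: "nat \<Rightarrow> ((nat \<Rightarrow> real) \<Rightarrow> real) \<Rightarrow> (nat \<Rightarrow> real) \<Rightarrow> real" where
  "pd i f z = deriv (\<lambda>t. f (z(i := t))) (z i)"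

primrec iter_pd :: "nat list \<Rightarrow> ((nat \<Rightarrow> real) \<Rightarrow> real) \<Rightarrow> (nat \<Rightarrow> real) \<Rightarrow> real" where
  "iter_pd [] f = f"
| "iter_pd (i # is) f = pd i (iter_pd is f)"

text \<open>On an open set, being of class C-infinity means that all iterated partial derivatives
  exist and are continuous.\<close>

definition smooth_fn :: "nat \<Rightarrow> (nat \<Rightarrow> real) set \<Rightarrow> ((nat \<Rightarrow> real) \<Rightarrow> real) \<Rightarrow> bool" where
  "smooth_fn m S f \<longleftrightarrow>
     (\<forall>is. set is \<subseteq> {..<m} \<longrightarrow>
        continuous_map (subtopology (Euclidean_space m) S) euclideanreal (iter_pd is f) \<and>
        (\<forall>z\<in>S. \<forall>i<m. (\<lambda>t. iter_pd is f (z(i := t))) differentiable at (z i)))"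


section \<open>Smooth manifolds\<close>

text \<open>A chart consists of its domain and its coordinate map.\<close>

type_synonym 'a chart = "'a set \<times> ('a \<Rightarrow> nat \<Rightarrow> real)"

definition chart_inv :: "'a chart \<Rightarrow> (nat \<Rightarrow> real) \<Rightarrow> 'a" where
  "chart_inv c = inv_into (fst c) (snd c)"

definition is_chart :: "nat \<Rightarrow> 'a topology \<Rightarrow> 'a chart \<Rightarrow> bool" where
  "is_chart n X c \<longleftrightarrow>
     openin X (fst c) \<and> openin (Euclidean_space n) (snd c ` fst c) \<and>
     homeomorphic_map (subtopology X (fst c))
       (subtopology (Euclidean_space n) (snd c ` fst c)) (snd c)"

definition second_countable :: "'a topology \<Rightarrow> bool" where
  "second_countable X \<longleftrightarrow>
     (\<exists>B. countable B \<and> (\<forall>V\<in>B. openin X V) \<and>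
          (\<forall>W x. openin X W \<and> x \<in> W \<longrightarrow> (\<exists>V\<in>B. x \<in> V \<and> V \<subseteq> W)))"

definition smooth_manifold :: "nat \<Rightarrow> 'a topology \<Rightarrow> 'a chart set \<Rightarrow> bool" where
  "smooth_manifold n X A \<longleftrightarrow>
     Hausdorff_space X \<and> second_countable X \<and>
     (\<forall>c\<in>A. is_chart n X c) \<and> (\<Union>c\<in>A. fst c) = topspace X \<and>
     (\<forall>c\<in>A. \<forall>d\<in>A. \<forall>i<n.
        smooth_fn n (snd c ` (fst c \<inter> fst d)) (\<lambda>x. snd d (chart_inv c x) i))"


section \<open>The tangent bundle\<close>

text \<open>
  A tangent vector at p assigns to every chart of the atlas around p a vector of R^n, its
  components in that chart, subject to the usual transformation law (Jacobian matrix of the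
  change of coordinates).  Charts that are not around p, or not in the atlas, get the
  value 0, so that tangent vectors with the same components are equal.
\<close>

type_synonym 'a tvec = "'a chart \<Rightarrow> nat \<Rightarrow> real"

definition tangent_space :: "nat \<Rightarrow> 'a chart set \<Rightarrow> 'a \<Rightarrow> 'a tvec set" where
  "tangent_space n A p =
     {v. (\<forall>c\<in>A. p \<in> fst c \<longrightarrow> v c \<in> topspace (Euclidean_space n)) \<and>
         (\<forall>c. c \<notin> A \<or> p \<notin> fst c \<longrightarrow> v c = (\<lambda>_. 0)) \<and>
         (\<forall>c\<in>A. \<forall>d\<in>A. p \<in> fst c \<and> p \<in> fst d \<longrightarrow>
            (\<forall>i<n. v d i =
               (\<Sum>j<n. pd j (\<lambda>x. snd d (chart_inv c x) i) (snd c p) * v c j)))}"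

definition slit_tangent_bundle ::
    "nat \<Rightarrow> 'a topology \<Rightarrow> 'a chart set \<Rightarrow> ('a \<times> 'a tvec) set" where
  "slit_tangent_bundle n X A =
     {(p, v). p \<in> topspace X \<and> v \<in> tangent_space n A p \<and> v \<noteq> (\<lambda>_ _. 0)}"

text \<open>
  The induced coordinates (x, y) on the tangent bundle over the domain of a chart c are packed
  into one point z of R^(2n):  z i is the i-th base coordinate and z (n + i) the i-th fibre
  coordinate, for i < n.  Accordingly \<open>pd i\<close> is the derivative in the i-th
  base direction and \<open>pd (n + i)\<close> the one in the i-th fibre direction.
\<close>

definition tdom :: "nat \<Rightarrow> 'a chart set \<Rightarrow> 'a chart \<Rightarrow> ('a \<times> 'a tvec) set" where
  "tdom n A c = {(p, v). p \<in> fst c \<and> v \<in> tangent_space n A p}"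

definition tcoords :: "nat \<Rightarrow> 'a chart \<Rightarrow> 'a \<times> 'a tvec \<Rightarrow> nat \<Rightarrow> real" where
  "tcoords n c = (\<lambda>(p, v) i.
     if i < n then snd c p i else if i < 2 * n then v c (i - n) else 0)"

definition coord_dom ::
    "nat \<Rightarrow> 'a chart set \<Rightarrow> ('a \<times> 'a tvec) set \<Rightarrow> 'a chart \<Rightarrow> (nat \<Rightarrow> real) set" where
  "coord_dom n A U c = tcoords n c ` (U \<inter> tdom n A c)"

definition local_rep ::
    "nat \<Rightarrow> 'a chart set \<Rightarrow> 'a chart \<Rightarrow> ('a \<times> 'a tvec \<Rightarrow> real) \<Rightarrow> (nat \<Rightarrow> real) \<Rightarrow> real" where
  "local_rep n A c F = F \<circ> inv_into (tdom n A c) (tcoords n c)"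


section \<open>Coordinate expressions of the Finslerian objects\<close>

text \<open>Here f is the coordinate expression of a Finsler function, z = (x, y).\<close>

definition metric_mat :: "nat \<Rightarrow> ((nat \<Rightarrow> real) \<Rightarrow> real) \<Rightarrow> (nat \<Rightarrow> real) \<Rightarrow> real mat" where
  "metric_mat n f z =
     mat n n (\<lambda>(i, j). 1 / 2 * pd (n + i) (pd (n + j) (\<lambda>w. (f w)\<^sup>2)) z)"

definition metric :: "nat \<Rightarrow> ((nat \<Rightarrow> real) \<Rightarrow> real) \<Rightarrow> nat \<Rightarrow> nat \<Rightarrow> (nat \<Rightarrow> real) \<Rightarrow> real" where
  "metric n f i j z = metric_mat n f z $$ (i, j)"

definition inv_metric :: "nat \<Rightarrow> ((nat \<Rightarrow> real) \<Rightarrow> real) \<Rightarrow> nat \<Rightarrow> nat \<Rightarrow> (nat \<Rightarrow> real) \<Rightarrow> real" where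
  "inv_metric n f i j z = the (mat_inverse (metric_mat n f z)) $$ (i, j)"

definition spray :: "nat \<Rightarrow> ((nat \<Rightarrow> real) \<Rightarrow> real) \<Rightarrow> nat \<Rightarrow> (nat \<Rightarrow> real) \<Rightarrow> real" where
  "spray n f h z = 1 / 4 * (\<Sum>l<n. inv_metric n f h l z *
     ((\<Sum>k<n. pd k (pd (n + l) (\<lambda>w. (f w)\<^sup>2)) z * z (n + k)) - pd l (\<lambda>w. (f w)\<^sup>2) z))"

definition berwald_tensor ::
    "nat \<Rightarrow> ((nat \<Rightarrow> real) \<Rightarrow> real) \<Rightarrow> nat \<Rightarrow> nat \<Rightarrow> nat \<Rightarrow> nat \<Rightarrow> (nat \<Rightarrow> real) \<Rightarrow> real" where
  "berwald_tensor n f h i j k = pd (n + i) (pd (n + j) (pd (n + k) (spray n f h)))"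

definition landsberg_tensor ::
    "nat \<Rightarrow> ((nat \<Rightarrow> real) \<Rightarrow> real) \<Rightarrow> nat \<Rightarrow> nat \<Rightarrow> nat \<Rightarrow> (nat \<Rightarrow> real) \<Rightarrow> real" where
  "landsberg_tensor n f i j k z =
     f z / 2 * (\<Sum>h<n. pd (n + h) f z * berwald_tensor n f h i j k z)"

definition nonlinear_connection ::
    "nat \<Rightarrow> ((nat \<Rightarrow> real) \<Rightarrow> real) \<Rightarrow> nat \<Rightarrow> nat \<Rightarrow> (nat \<Rightarrow> real) \<Rightarrow> real" where
  "nonlinear_connection n f m j = pd (n + j) (spray n f m)"

definition horizontal_deriv :: "nat \<Rightarrow> ((nat \<Rightarrow> real) \<Rightarrow> real) \<Rightarrow> nat \<Rightarrow>
    ((nat \<Rightarrow> real) \<Rightarrow> real) \<Rightarrow> (nat \<Rightarrow> real) \<Rightarrow> real" where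
  "horizontal_deriv n f j \<phi> z =
     pd j \<phi> z - (\<Sum>m<n. nonlinear_connection n f m j z * pd (n + m) \<phi> z)"

definition chern_coeff ::
    "nat \<Rightarrow> ((nat \<Rightarrow> real) \<Rightarrow> real) \<Rightarrow> nat \<Rightarrow> nat \<Rightarrow> nat \<Rightarrow> (nat \<Rightarrow> real) \<Rightarrow> real" where
  "chern_coeff n f i h j z = 1 / 2 * (\<Sum>l<n. inv_metric n f i l z *
     (horizontal_deriv n f h (metric n f l j) z
      + horizontal_deriv n f j (metric n f h l) z
      - horizontal_deriv n f l (metric n f h j) z))"

text \<open>The sign of the hv-curvature depends on conventions; only its vanishing matters below.\<close>

definition chern_hv_curvature ::
    "nat \<Rightarrow> ((nat \<Rightarrow> real) \<Rightarrow> real) \<Rightarrow> nat \<Rightarrow> nat \<Rightarrow> nat \<Rightarrow> nat \<Rightarrow> (nat \<Rightarrow> real) \<Rightarrow> real" where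
  "chern_hv_curvature n f i h j k = pd (n + k) (chern_coeff n f i h j)"


section \<open>Finsler functions, Landsberg and Berwald spaces\<close>

definition finsler_function ::
    "nat \<Rightarrow> 'a topology \<Rightarrow> 'a chart set \<Rightarrow> ('a \<times> 'a tvec) set \<Rightarrow> ('a \<times> 'a tvec \<Rightarrow> real) \<Rightarrow> bool"
  where
  "finsler_function n X A U F \<longleftrightarrow>
     U \<subseteq> slit_tangent_bundle n X A \<and>
     (\<forall>c\<in>A. openin (Euclidean_space (2 * n)) (coord_dom n A U c)) \<and>
     (\<forall>(p, v)\<in>U. \<forall>r>0. (p, \<lambda>c i. r * v c i) \<in> U) \<and>
     (\<forall>u\<in>U. F u > 0) \<and>
     (\<forall>c\<in>A. smooth_fn (2 * n) (coord_dom n A U c) (local_rep n A c F)) \<and>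
     (\<forall>(p, v)\<in>U. \<forall>r>0. F (p, \<lambda>c i. r * v c i) = r * F (p, v)) \<and>
     (\<forall>c\<in>A. \<forall>z\<in>coord_dom n A U c.
        Determinant.det (metric_mat n (local_rep n A c F) z) \<noteq> 0)"

definition nonregular_finsler_function ::
    "nat \<Rightarrow> 'a topology \<Rightarrow> 'a chart set \<Rightarrow> ('a \<times> 'a tvec) set \<Rightarrow> ('a \<times> 'a tvec \<Rightarrow> real) \<Rightarrow> bool"
  where
  "nonregular_finsler_function n X A U F \<longleftrightarrow>
     finsler_function n X A U F \<and>
     \<not> (\<exists>F'. finsler_function n X A (slit_tangent_bundle n X A) F' \<and> (\<forall>u\<in>U. F' u = F u))"

definition landsbergian ::
    "nat \<Rightarrow> 'a chart set \<Rightarrow> ('a \<times> 'a tvec) set \<Rightarrow> ('a \<times> 'a tvec \<Rightarrow> real) \<Rightarrow> bool" where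
  "landsbergian n A U F \<longleftrightarrow>
     (\<forall>c\<in>A. \<forall>z\<in>coord_dom n A U c. \<forall>i<n. \<forall>j<n. \<forall>k<n.
        landsberg_tensor n (local_rep n A c F) i j k z = 0)"

definition berwaldian ::
    "nat \<Rightarrow> 'a chart set \<Rightarrow> ('a \<times> 'a tvec) set \<Rightarrow> ('a \<times> 'a tvec \<Rightarrow> real) \<Rightarrow> bool" where
  "berwaldian n A U F \<longleftrightarrow>
     (\<forall>c\<in>A. \<forall>z\<in>coord_dom n A U c. \<forall>i<n. \<forall>h<n. \<forall>j<n. \<forall>k<n.
        chern_hv_curvature n (local_rep n A c F) i h j k z = 0)"

end

theory Submission
  imports Defs
begin

text \<open>
  On R^3 let W = e^t (a b)^(1/2), where u, a, b are the fibre coordinates over t and the other two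
  base coordinates, and let F = (W + 2 u)^2 / (W + u) where a, b, W + 2 u > 0.  This belongs to
  Shen's family of functions Phi (u, W) with Phi_u / Phi = (c + k u) / (1 + c u + k u^2) at W = 1
  (here c = 3, k = 2), for which Phi_uu / Phi = k / (1 + c u + k u^2)^2 and the spray becomes
  G^0 = - W^2 / (2 k) and G^i = (u + c / (2 k) W) y^i, i = 1, 2.
  As W^2 is quadratic in y, only the terms W y^i contribute to the Berwald tensor.
  They do contribute, but sum_i F_(y^i) (W y^i)_jkl is proportional to
  sum_i W_(y^i) (W y^i)_jkl = (W^2)_jkl / 2 = 0.
  Finally F tends to 0 at nonzero vectors with W + 2 u = 0, so by positivity it has no extension.
\<close>

section \<open>Partial derivatives on open subsets of coordinate space\<close>

text \<open>\<open>deriv\<close> returns an unspecified value where no derivative exists. Recording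
  existence together with the value lets the rules of calculus be chained; \<open>pd\<close> is read
  off afterwards.\<close>

definition has_pd :: "nat \<Rightarrow> ((nat \<Rightarrow> real) \<Rightarrow> real) \<Rightarrow> real \<Rightarrow> (nat \<Rightarrow> real) \<Rightarrow> bool" where
  "has_pd i f d z \<longleftrightarrow> ((\<lambda>t. f (z(i := t))) has_real_derivative d) (at (z i))"

lemma has_pd_imp_pd: "has_pd i f d z \<Longrightarrow> pd i f z = d"
  unfolding has_pd_def pd_def by (rule DERIV_imp_deriv)

text \<open>Bridge to the type class topology on sequences, where \<open>open\<close>,
  \<open>continuous_on\<close> and their rules are available.\<close>

lemma Euclidean_space_top_of_set:
  "Euclidean_space m = top_of_set (topspace (Euclidean_space m))"
  by (simp add: Euclidean_space_def euclidean_product_topology topspace_Euclidean_space)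

lemma continuous_map_Euclidean_space_iff:
  assumes "S \<subseteq> topspace (Euclidean_space m)"
  shows "continuous_map (subtopology (Euclidean_space m) S) euclideanreal f \<longleftrightarrow> continuous_on S f"
  using assms
  by (subst Euclidean_space_top_of_set) (simp add: subtopology_subtopology Int_absorb1)

lemma fun_upd_in_Euclidean_space:
  assumes "z \<in> topspace (Euclidean_space m)" "i < m"
  shows "z(i := t) \<in> topspace (Euclidean_space m)"
  using assms by (auto simp: topspace_Euclidean_space)

lemma continuous_on_fun_upd: "continuous_on UNIV (\<lambda>t. (z :: nat \<Rightarrow> real)(i := t))"
proof (rule continuous_on_coordinatewise_then_product)
  show "continuous_on UNIV (\<lambda>t. (z(i := t)) j)" for j
    by (cases "j = i") auto
qed

lemma eventually_fun_upd_in: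
  assumes S: "openin (Euclidean_space m) S" and z: "z \<in> S" and i: "i < m"
  shows "\<forall>\<^sub>F t in nhds (z i). z(i := t) \<in> S"
proof -
  have sub: "S \<subseteq> topspace (Euclidean_space m)"
    using S by (rule openin_subset)
  obtain T where T: "open T" "S = topspace (Euclidean_space m) \<inter> T"
    using S by (subst (asm) Euclidean_space_top_of_set) (auto simp: openin_open)
  have "open ((\<lambda>t. z(i := t)) -` T)"
    using T(1) continuous_on_fun_upd[of z i] by (simp add: continuous_on_open_vimage)
  moreover have "z i \<in> (\<lambda>t. z(i := t)) -` T"
    using z T by simp
  ultimately have "\<forall>\<^sub>F t in nhds (z i). t \<in> (\<lambda>t. z(i := t)) -` T"
    by (rule eventually_nhds_in_open)
  then show ?thesis
    by eventually_elim (use T z sub i fun_upd_in_Euclidean_space in blast)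
qed

lemma has_pd_cong:
  assumes "openin (Euclidean_space m) S" "\<And>w. w \<in> S \<Longrightarrow> f w = g w" "z \<in> S" "i < m"
  shows "has_pd i f d z \<longleftrightarrow> has_pd i g d z"
  unfolding has_pd_def
  by (rule DERIV_cong_ev) (use assms eventually_fun_upd_in[of m S z i] in \<open>auto elim: eventually_mono\<close>)

text \<open>Partial derivatives are local: near \<open>z\<close> the coordinate line stays in the
  open set \<open>S\<close>, so a function known only on \<open>S\<close> may be exchanged for a
  closed form. Iterated derivatives are computed by repeating this.\<close>

lemma pd_eqI:
  assumes "openin (Euclidean_space m) S" "\<And>w. w \<in> S \<Longrightarrow> f w = g w" "z \<in> S" "i < m"
    and "has_pd i g d z"
  shows "pd i f z = d"
  using assms has_pd_cong[of m S f g z i d] by (simp add: has_pd_imp_pd)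

text \<open>By induction on the list of directions, every iterated derivative of \<open>f\<close>
  agrees on \<open>S\<close> with a member of \<open>R\<close>. Smoothness is thus reduced to
  exhibiting a family of continuous functions closed under differentiation.\<close>

lemma smooth_fnI:
  assumes S: "openin (Euclidean_space m) S"
    and cont: "\<And>g. g \<in> R \<Longrightarrow> continuous_on S g"
    and closed: "\<And>g i. g \<in> R \<Longrightarrow> i < m \<Longrightarrow> \<exists>g'\<in>R. \<forall>z\<in>S. has_pd i g (g' z) z"
    and f: "g \<in> R" "\<And>z. z \<in> S \<Longrightarrow> f z = g z"
  shows "smooth_fn m S f"
proof -
  have iter: "\<exists>g\<in>R. \<forall>z\<in>S. iter_pd is f z = g z" if "set is \<subseteq> {..<m}" for "is"
    using that
  proof (induction "is")
    case Nil
    then show ?case using f by auto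
  next
    case (Cons i "is")
    then obtain g where g: "g \<in> R" "\<And>z. z \<in> S \<Longrightarrow> iter_pd is f z = g z"
      by auto
    have i: "i < m" using Cons.prems by simp
    obtain g' where g': "g' \<in> R" "\<And>z. z \<in> S \<Longrightarrow> has_pd i g (g' z) z"
      using closed[OF g(1) i] by blast
    have "iter_pd (i # is) f z = g' z" if "z \<in> S" for z
      using pd_eqI[OF S g(2) that i g'(2)[OF that]] by simp
    then show ?case using g'(1) by blast
  qed
  have sub: "S \<subseteq> topspace (Euclidean_space m)"
    using S by (rule openin_subset)
  show ?thesis
    unfolding smooth_fn_def continuous_map_Euclidean_space_iff[OF sub]
  proof (intro allI impI conjI ballI)
    fix "is" assume "is": "set is \<subseteq> {..<m}"
    obtain g where g: "g \<in> R" "\<And>z. z \<in> S \<Longrightarrow> iter_pd is f z = g z"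
      using iter[OF "is"] by blast
    show "continuous_on S (iter_pd is f)"
      using cont[OF g(1)] g(2) by (simp cong: continuous_on_cong)
    fix z i assume z: "z \<in> S" and i: "i < m"
    obtain d where "has_pd i g d z"
      using closed[OF g(1) i] z by blast
    then have "has_pd i (iter_pd is f) d z"
      using has_pd_cong[of m S "iter_pd is f" g z i d] S g(2) z i by simp
    then show "(\<lambda>t. iter_pd is f (z(i := t))) differentiable at (z i)"
      unfolding has_pd_def using real_differentiable_def by blast
  qed
qed

lemma smooth_fn_coordinate:
  assumes "\<And>z. z \<in> topspace (Euclidean_space m) \<Longrightarrow> f z = z i"
  shows "smooth_fn m (topspace (Euclidean_space m)) f"
\<comment> \<open>A coordinate function together with all constants is such a family, its
  derivatives being 0 or 1.\<close>
proof (rule smooth_fnI[where R = "insert (\<lambda>z. z i) (range (\<lambda>c _. c))" and g = "\<lambda>z. z i"])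
  show "openin (Euclidean_space m) (topspace (Euclidean_space m))" by simp
next
  fix g :: "(nat \<Rightarrow> real) \<Rightarrow> real" assume "g \<in> insert (\<lambda>z. z i) (range (\<lambda>c _. c))"
  then show "continuous_on (topspace (Euclidean_space m)) g"
    by (auto intro: continuous_on_subset[OF continuous_on_product_coordinates])
next
  fix g :: "(nat \<Rightarrow> real) \<Rightarrow> real" and j assume "g \<in> insert (\<lambda>z. z i) (range (\<lambda>c _. c))"
  then consider "g = (\<lambda>z. z i)" | c where "g = (\<lambda>_. c)" by auto
  then show "\<exists>g'\<in>insert (\<lambda>z. z i) (range (\<lambda>c _. c)).
      \<forall>z\<in>topspace (Euclidean_space m). has_pd j g (g' z) z"
  proof cases
    case 1
    then have "has_pd j g (of_bool (i = j)) z" for z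
      unfolding has_pd_def by (cases "i = j") auto
    then show ?thesis by (intro bexI[of _ "\<lambda>_. of_bool (i = j)"]) auto
  next
    case 2
    then show ?thesis by (intro bexI[of _ "\<lambda>_. 0"]) (auto simp: has_pd_def)
  qed
qed (use assms in auto)

section \<open>The manifold R^n with its standard chart\<close>

definition std_chart :: "nat \<Rightarrow> (nat \<Rightarrow> real) chart" where
  "std_chart n = (topspace (Euclidean_space n), id)"

lemma fst_std_chart [simp]: "fst (std_chart n) = topspace (Euclidean_space n)"
  and snd_std_chart [simp]: "snd (std_chart n) = id"
  by (simp_all add: std_chart_def)

lemma chart_inv_std_chart:
  "x \<in> topspace (Euclidean_space n) \<Longrightarrow> chart_inv (std_chart n) x = x"
  unfolding chart_inv_def by (simp add: inv_into_f_eq)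

text \<open>The traces on \<open>S\<close> of a countable basis of the ambient space form a basis of
  the subspace.\<close>

lemma second_countable_top_of_set:
  "second_countable (top_of_set (S :: 'a :: second_countable_topology set))"
proof -
  obtain B :: "'a set set" where B: "countable B" "topological_basis B"
    using ex_countable_basis by blast
  have "\<exists>V\<in>(\<inter>) S ` B. x \<in> V \<and> V \<subseteq> W" if W: "openin (top_of_set S) W" "x \<in> W" for W x
  proof -
    obtain T where T: "open T" "W = S \<inter> T"
      using W by (auto simp: openin_open)
    have "x \<in> T" using W T by simp
    then obtain V where "V \<in> B" "x \<in> V" "V \<subseteq> T"
      by (rule topological_basisE[OF B(2) T(1)])
    then show ?thesis using T W by auto
  qed
  moreover have "openin (top_of_set S) (S \<inter> V)" if "V \<in> B" for V
    using topological_basis_open[OF B(2) that] by (rule openin_open_Int)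
  ultimately show ?thesis
    unfolding second_countable_def
    by (intro exI[of _ "(\<inter>) S ` B"]) (use B(1) in auto)
qed

text \<open>With a single chart the only change of coordinates is the identity of R^n.\<close>

lemma smooth_manifold_std:
  "smooth_manifold n (Euclidean_space n) {std_chart n}"
  unfolding smooth_manifold_def
proof (intro conjI ballI allI impI)
  show "Hausdorff_space (Euclidean_space n)"
    by (rule Hausdorff_Euclidean_space)
  show "second_countable (Euclidean_space n)"
    by (subst Euclidean_space_top_of_set) (rule second_countable_top_of_set)
  show "(\<Union>c\<in>{std_chart n}. fst c) = topspace (Euclidean_space n)"
    by simp
next
  fix c :: "(nat \<Rightarrow> real) chart" assume "c \<in> {std_chart n}"
  then show "is_chart n (Euclidean_space n) c"
    unfolding is_chart_def by (simp add: homeomorphic_map_id)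
next
  fix c d :: "(nat \<Rightarrow> real) chart" and i
  assume "c \<in> {std_chart n}" "d \<in> {std_chart n}" "i < n"
  moreover have "smooth_fn n (topspace (Euclidean_space n)) (\<lambda>x. chart_inv (std_chart n) x i)"
    by (rule smooth_fn_coordinate) (simp add: chart_inv_std_chart)
  ultimately show "smooth_fn n (snd c ` (fst c \<inter> fst d)) (\<lambda>x. snd d (chart_inv c x) i)"
    by simp
qed

section \<open>Tangent vectors and induced coordinates over the standard chart\<close>

definition std_vec :: "nat \<Rightarrow> (nat \<Rightarrow> real) \<Rightarrow> (nat \<Rightarrow> real) tvec" where
  "std_vec n y c = (if c = std_chart n then y else (\<lambda>_. 0))"

lemma std_vec_eq_0_iff: "std_vec n y = (\<lambda>_ _. 0) \<longleftrightarrow> y = (\<lambda>_. 0)"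
  by (metis std_vec_def)

lemma pd_std_transition:
  assumes "p \<in> topspace (Euclidean_space n)" "j < n"
  shows "pd j (\<lambda>x. chart_inv (std_chart n) x i) p = of_bool (i = j)"
proof -
  have "(\<lambda>t. chart_inv (std_chart n) (p(j := t)) i) = (\<lambda>t. (p(j := t)) i)"
    using assms by (simp add: chart_inv_std_chart fun_upd_in_Euclidean_space)
  then show ?thesis
    unfolding pd_def by (cases "i = j") auto
qed

text \<open>The only transformation law relates the chart to itself through the identity Jacobian,
  so every vector of R^n is admissible; the value 0 at all other charts makes its components
  determine the tangent vector.\<close>

lemma tangent_space_std:
  assumes p: "p \<in> topspace (Euclidean_space n)"
  shows "tangent_space n {std_chart n} p = std_vec n ` topspace (Euclidean_space n)"
proof (intro subset_antisym subsetI)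
  fix v assume "v \<in> tangent_space n {std_chart n} p"
  then have v: "v (std_chart n) \<in> topspace (Euclidean_space n)"
    "c \<noteq> std_chart n \<Longrightarrow> v c = (\<lambda>_. 0)" for c
    using p by (auto simp: tangent_space_def simp del: split_paired_All)
  then have "v = std_vec n (v (std_chart n))"
    by (simp add: std_vec_def fun_eq_iff del: split_paired_All)
  with v(1) show "v \<in> std_vec n ` topspace (Euclidean_space n)"
    by blast
next
  fix v assume "v \<in> std_vec n ` topspace (Euclidean_space n)"
  then obtain y where y: "y \<in> topspace (Euclidean_space n)" "v = std_vec n y"
    by blast
  have "(\<Sum>j<n. pd j (\<lambda>x. chart_inv (std_chart n) x i) p * y j) = y i" if "i < n" for i
  proof -
    have "(\<Sum>j<n. pd j (\<lambda>x. chart_inv (std_chart n) x i) p * y j) = (\<Sum>j<n. if i = j then y j else 0)"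
      by (rule sum.cong) (auto simp: pd_std_transition[OF p])
    then show ?thesis using that by simp
  qed
  then show "v \<in> tangent_space n {std_chart n} p"
    using y p by (auto simp: tangent_space_def std_vec_def)
qed

text \<open>The inverse of \<open>tcoords\<close>. Cutting off base and fibre components at
  \<open>n\<close> yields a point of the tangent bundle for every sequence \<open>z\<close>.\<close>

definition bundle_point :: "nat \<Rightarrow> (nat \<Rightarrow> real) \<Rightarrow> (nat \<Rightarrow> real) \<times> (nat \<Rightarrow> real) tvec" where
  "bundle_point n z =
     (\<lambda>i. if i < n then z i else 0, std_vec n (\<lambda>i. if i < n then z (n + i) else 0))"

lemma bundle_point_in_tdom: "bundle_point n z \<in> tdom n {std_chart n} (std_chart n)"
proof -
  have "(\<lambda>i. if i < n then z i else 0) \<in> topspace (Euclidean_space n)"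
    "(\<lambda>i. if i < n then z (n + i) else 0) \<in> topspace (Euclidean_space n)"
    by (auto simp: topspace_Euclidean_space)
  then show ?thesis
    by (auto simp: bundle_point_def tdom_def tangent_space_std)
qed

lemma tcoords_bundle_point:
  assumes "z \<in> topspace (Euclidean_space (2 * n))"
  shows "tcoords n (std_chart n) (bundle_point n z) = z"
proof
  fix i show "tcoords n (std_chart n) (bundle_point n z) i = z i"
    using assms by (auto simp: tcoords_def bundle_point_def std_vec_def topspace_Euclidean_space)
qed

lemma tdom_std_cases:
  assumes "u \<in> tdom n {std_chart n} (std_chart n)"
  obtains z where "z \<in> topspace (Euclidean_space (2 * n))" "u = bundle_point n z"
proof -
  obtain p y where u: "u = (p, std_vec n y)" "p \<in> topspace (Euclidean_space n)"
    "y \<in> topspace (Euclidean_space n)"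
    using assms by (auto simp: tdom_def tangent_space_std)
  define z where "z = (\<lambda>i. if i < n then p i else if i < 2 * n then y (i - n) else 0)"
  have "p = (\<lambda>i. if i < n then z i else 0)" "y = (\<lambda>i. if i < n then z (n + i) else 0)"
    using u by (auto simp: z_def topspace_Euclidean_space fun_eq_iff)
  then have "u = bundle_point n z"
    unfolding bundle_point_def u(1) by simp
  moreover have "z \<in> topspace (Euclidean_space (2 * n))"
    by (auto simp: z_def topspace_Euclidean_space)
  ultimately show ?thesis by (rule that[rotated])
qed

lemma inv_into_tcoords:
  assumes "z \<in> topspace (Euclidean_space (2 * n))"
  shows "inv_into (tdom n {std_chart n} (std_chart n)) (tcoords n (std_chart n)) z = bundle_point n z"
proof (rule inv_into_f_eq)
  show "inj_on (tcoords n (std_chart n)) (tdom n {std_chart n} (std_chart n))"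
    by (rule inj_on_inverseI[of _ "bundle_point n"]) (auto elim!: tdom_std_cases simp: tcoords_bundle_point)
qed (use assms bundle_point_in_tdom tcoords_bundle_point in auto)

lemma local_rep_std:
  assumes "z \<in> topspace (Euclidean_space (2 * n))"
  shows "local_rep n {std_chart n} (std_chart n) F z = F (bundle_point n z)"
  using assms by (simp add: local_rep_def inv_into_tcoords)

lemma coord_dom_std:
  assumes "V \<subseteq> topspace (Euclidean_space (2 * n))"
  shows "coord_dom n {std_chart n} (bundle_point n ` V) (std_chart n) = V"
proof -
  have "bundle_point n ` V \<inter> tdom n {std_chart n} (std_chart n) = bundle_point n ` V"
    using bundle_point_in_tdom by blast
  moreover have "tcoords n (std_chart n) ` bundle_point n ` V = V"
    using assms by (force simp: tcoords_bundle_point)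
  ultimately show ?thesis
    by (simp add: coord_dom_def)
qed

text \<open>Fibre dilation in packed coordinates. Indices from \<open>2 * n\<close> on are
  multiplied too, which changes nothing on R^(2n), where these entries are 0.\<close>

definition scale_fibre :: "nat \<Rightarrow> real \<Rightarrow> (nat \<Rightarrow> real) \<Rightarrow> nat \<Rightarrow> real" where
  "scale_fibre n r z i = (if i < n then z i else r * z i)"

lemma bundle_point_scale_fibre:
  "(fst (bundle_point n z), \<lambda>c i. r * snd (bundle_point n z) c i) = bundle_point n (scale_fibre n r z)"
  by (auto simp: bundle_point_def std_vec_def scale_fibre_def fun_eq_iff)

lemma bundle_point_in_slit:
  assumes "z \<in> topspace (Euclidean_space (2 * n))"
  shows "bundle_point n z \<in> slit_tangent_bundle n (Euclidean_space n) {std_chart n} \<longleftrightarrow>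
     (\<exists>i<n. z (n + i) \<noteq> 0)"
proof -
  have "snd (bundle_point n z) = (\<lambda>_ _. 0) \<longleftrightarrow> (\<forall>i<n. z (n + i) = 0)"
    by (simp add: bundle_point_def std_vec_eq_0_iff) (auto simp: fun_eq_iff)
  moreover have "fst (bundle_point n z) \<in> topspace (Euclidean_space n)"
    "snd (bundle_point n z) \<in> tangent_space n {std_chart n} (fst (bundle_point n z))"
    using bundle_point_in_tdom[of n z] by (auto simp: tdom_def)
  ultimately show ?thesis
    by (auto simp: slit_tangent_bundle_def split_beta)
qed

lemma slit_tangent_bundle_std:
  "slit_tangent_bundle n (Euclidean_space n) {std_chart n} =
     bundle_point n ` {z \<in> topspace (Euclidean_space (2 * n)). \<exists>i<n. z (n + i) \<noteq> 0}"
proof (intro subset_antisym subsetI)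
  fix u assume u: "u \<in> slit_tangent_bundle n (Euclidean_space n) {std_chart n}"
  then have "u \<in> tdom n {std_chart n} (std_chart n)"
    by (auto simp: slit_tangent_bundle_def tdom_def)
  then obtain z where z: "z \<in> topspace (Euclidean_space (2 * n))" "u = bundle_point n z"
    by (rule tdom_std_cases)
  then show "u \<in> bundle_point n ` {z \<in> topspace (Euclidean_space (2 * n)). \<exists>i<n. z (n + i) \<noteq> 0}"
    using u bundle_point_in_slit[OF z(1)] by auto
qed (auto simp: bundle_point_in_slit)

section \<open>The Finsler function in coordinates\<close>

text \<open>
  The point z = (t, x, x', u, a, b) is numbered 0 to 5.  With h = W + u in place of W, all tensors
  below are rational functions of u, h, a, b, because h is closed under differentiation:
  its derivatives in t, u, a are h - u, 1 and (h - u) / (2 a).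
\<close>

definition W :: "(nat \<Rightarrow> real) \<Rightarrow> real" where
  "W z = exp (z 0) * sqrt (z 4 * z 5)"

definition h :: "(nat \<Rightarrow> real) \<Rightarrow> real" where
  "h z = W z + z 3"

definition Phi :: "(nat \<Rightarrow> real) \<Rightarrow> real" where
  "Phi z = (h z + z 3)\<^sup>2 / h z"

definition V :: "(nat \<Rightarrow> real) set" where
  "V = {z \<in> topspace (Euclidean_space 6). z 4 > 0 \<and> z 5 > 0 \<and> h z + z 3 > 0}"

lemma W_pos: "z 4 > 0 \<Longrightarrow> z 5 > 0 \<Longrightarrow> W z > 0"
  by (simp add: W_def)

lemma V_D:
  assumes "z \<in> V"
  shows "z \<in> topspace (Euclidean_space 6)" "z 4 > 0" "z 5 > 0" "h z + z 3 > 0" "h z - z 3 > 0" "h z > 0"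
proof -
  show *: "z \<in> topspace (Euclidean_space 6)" "z 4 > 0" "z 5 > 0" "h z + z 3 > 0"
    using assms by (auto simp: V_def)
  show "h z - z 3 > 0"
    using W_pos[OF *(2,3)] by (simp add: h_def)
  \<comment> \<open>\<open>2 * h z\<close> is the sum of h + u and h - u, both positive.\<close>
  then show "h z > 0"
    using *(4) by linarith
qed

lemma V_nonzero:
  assumes "z \<in> V"
  shows "z 4 \<noteq> 0" "z 5 \<noteq> 0" "h z + z 3 \<noteq> 0" "h z - z 3 \<noteq> 0" "h z \<noteq> 0"
  using V_D[OF assms] by auto

lemma DERIV_W:
  "((\<lambda>t. W (z(0 := t))) has_real_derivative W z) (at (z 0))"
  "((\<lambda>t. W (z(Suc 0 := t))) has_real_derivative 0) (at (z (Suc 0)))"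
  "((\<lambda>t. W (z(2 := t))) has_real_derivative 0) (at (z 2))"
  "((\<lambda>t. W (z(3 := t))) has_real_derivative 0) (at (z 3))"
  unfolding W_def by (auto intro!: derivative_eq_intros)

lemma DERIV_W_fibre:
  assumes "z 4 > 0" "z 5 > 0"
  shows "((\<lambda>t. W (z(4 := t))) has_real_derivative W z / (2 * z 4)) (at (z 4))"
    and "((\<lambda>t. W (z(5 := t))) has_real_derivative W z / (2 * z 5)) (at (z 5))"
  unfolding W_def using assms
  by (auto intro!: derivative_eq_intros simp: real_sqrt_mult field_simps)

lemma DERIV_h [derivative_intros]:
  assumes "z \<in> V"
  shows "((\<lambda>t. h (z(0 := t))) has_real_derivative h z - z 3) (at (z 0))"
    and "((\<lambda>t. h (z(Suc 0 := t))) has_real_derivative 0) (at (z (Suc 0)))"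
    and "((\<lambda>t. h (z(2 := t))) has_real_derivative 0) (at (z 2))"
    and "((\<lambda>t. h (z(3 := t))) has_real_derivative 1) (at (z 3))"
    and "((\<lambda>t. h (z(4 := t))) has_real_derivative (h z - z 3) / (2 * z 4)) (at (z 4))"
    and "((\<lambda>t. h (z(5 := t))) has_real_derivative (h z - z 3) / (2 * z 5)) (at (z 5))"
  using V_D[OF assms] unfolding h_def
  by (auto intro!: derivative_eq_intros DERIV_W DERIV_W_fibre)

lemma open_V: "openin (Euclidean_space 6) V"
proof -
  have "open {z. 0 < z 4 \<and> 0 < z 5 \<and> 0 < h z + z 3}"
    unfolding h_def W_def
    by (intro open_Collect_conj open_Collect_less continuous_intros
        continuous_on_product_coordinates continuous_on_const)
  then have "openin (top_of_set (topspace (Euclidean_space 6)))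
      (topspace (Euclidean_space 6) \<inter> {z. 0 < z 4 \<and> 0 < z 5 \<and> 0 < h z + z 3})"
    by (rule openin_open_Int)
  moreover have "topspace (Euclidean_space 6) \<inter> {z. 0 < z 4 \<and> 0 < z 5 \<and> 0 < h z + z 3} = V"
    by (auto simp: V_def)
  ultimately show ?thesis
    by (simp flip: Euclidean_space_top_of_set)
qed

section \<open>Smoothness of \<open>Phi\<close>\<close>

lemma less_6_cases:
  assumes "i < (6::nat)"
  obtains "i = 0" | "i = Suc 0" | "i = 2" | "i = 3" | "i = 4" | "i = 5"
  using assms by linarith

text \<open>The ring generated by the constants, u, a, b, h and the inverses of a, b, h. It is
  closed under all six partial derivatives on \<open>V\<close> and contains an expression for
  \<open>Phi\<close>, so it serves as the family in \<open>smooth_fnI\<close>; t enters only through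
  \<open>h\<close>.\<close>

inductive_set coeff_fns :: "((nat \<Rightarrow> real) \<Rightarrow> real) set" where
  const: "(\<lambda>_. c) \<in> coeff_fns"
| coord: "i \<in> {3, 4, 5} \<Longrightarrow> (\<lambda>z. z i) \<in> coeff_fns"
| h: "h \<in> coeff_fns"
| inv_coord: "i \<in> {4, 5} \<Longrightarrow> (\<lambda>z. inverse (z i)) \<in> coeff_fns"
| inv_h: "(\<lambda>z. inverse (h z)) \<in> coeff_fns"
| add: "f \<in> coeff_fns \<Longrightarrow> g \<in> coeff_fns \<Longrightarrow> (\<lambda>z. f z + g z) \<in> coeff_fns"
| mult: "f \<in> coeff_fns \<Longrightarrow> g \<in> coeff_fns \<Longrightarrow> (\<lambda>z. f z * g z) \<in> coeff_fns"

lemma continuous_on_h: "continuous_on S h"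
  unfolding h_def W_def
  by (intro continuous_intros continuous_on_subset[OF continuous_on_product_coordinates]) auto

lemma continuous_on_coeff_fns: "f \<in> coeff_fns \<Longrightarrow> continuous_on V f"
proof (induction rule: coeff_fns.induct)
  case (coord i)
  show ?case by (auto intro: continuous_on_subset[OF continuous_on_product_coordinates])
next
  case (inv_coord i)
  then show ?case
    by (intro continuous_on_inverse continuous_on_subset[OF continuous_on_product_coordinates])
      (auto dest: V_nonzero)
next
  case inv_h
  show ?case by (intro continuous_on_inverse continuous_on_h) (auto dest: V_nonzero)
qed (auto intro!: continuous_on_add continuous_on_mult continuous_on_h)

lemma has_pd_h:
  assumes "j < 6"
  shows "\<exists>g\<in>coeff_fns. \<forall>z\<in>V. has_pd j h (g z) z"
proof -
  \<comment> \<open>The derivatives from \<open>DERIV_h\<close>, rewritten with sums, products and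
    inverses, the operations that build \<open>coeff_fns\<close>.\<close>
  let ?dt = "\<lambda>z. h z + (-1) * z 3"
    and ?da = "\<lambda>z. (h z + (-1) * z 3) * ((1/2) * inverse (z 4))"
    and ?db = "\<lambda>z. (h z + (-1) * z 3) * ((1/2) * inverse (z 5))"
  have mem: "?dt \<in> coeff_fns" "?da \<in> coeff_fns" "?db \<in> coeff_fns"
    by (intro coeff_fns.intros; simp)+
  have eq: "?dt z = h z - z 3"
    "(h z - z 3) * ((1/2) * inverse (z 4)) = (h z - z 3) / (2 * z 4)"
    "(h z - z 3) * ((1/2) * inverse (z 5)) = (h z - z 3) / (2 * z 5)" for z
    by (simp_all add: field_simps)
  have pd: "has_pd 0 h (?dt z) z" "has_pd (Suc 0) h 0 z" "has_pd 2 h 0 z" "has_pd 3 h 1 z"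
    "has_pd 4 h (?da z) z" "has_pd 5 h (?db z) z" if "z \<in> V" for z
    unfolding has_pd_def eq by (rule DERIV_h[OF that])+
  consider "j = 0" | "j \<in> {Suc 0, 2}" | "j = 3" | "j = 4" | "j = 5"
    using assms by (auto elim: less_6_cases)
  then show ?thesis
  proof cases
    case 1
    then show ?thesis using pd(1) by (intro bexI[OF _ mem(1)]) simp
  next
    case 2
    then show ?thesis using pd(2,3) by (intro bexI[OF _ coeff_fns.const[of 0]]) auto
  next
    case 3
    then show ?thesis using pd(4) by (intro bexI[OF _ coeff_fns.const[of 1]]) simp
  next
    case 4
    then show ?thesis using pd(5) by (intro bexI[OF _ mem(2)]) simp
  next
    case 5
    then show ?thesis using pd(6) by (intro bexI[OF _ mem(3)]) simp
  qed
qed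

text \<open>Once the generators are settled, the sum and product rules keep derivatives inside the
  ring.\<close>

lemma has_pd_coeff_fns:
  assumes "f \<in> coeff_fns" "j < 6"
  shows "\<exists>g\<in>coeff_fns. \<forall>z\<in>V. has_pd j f (g z) z"
  using assms(1)
proof (induction rule: coeff_fns.induct)
  case (const c)
  show ?case by (intro bexI[OF _ coeff_fns.const[of 0]]) (auto simp: has_pd_def)
next
  case (coord i)
  show ?case
    by (intro bexI[OF _ coeff_fns.const[of "of_bool (i = j)"]]) (auto simp: has_pd_def)
next
  case h
  show ?case by (rule has_pd_h[OF assms(2)])
next
  case (inv_coord i)
  have "(\<lambda>z. of_bool (i = j) * (-1) * (inverse (z i) * inverse (z i))) \<in> coeff_fns"
    by (intro coeff_fns.mult coeff_fns.const coeff_fns.inv_coord inv_coord)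
  then show ?case
  proof (rule bexI[rotated], intro ballI)
    fix z assume "z \<in> V"
    then have "z i \<noteq> 0" using inv_coord V_nonzero by auto
    then show "has_pd j (\<lambda>z. inverse (z i)) (of_bool (i = j) * (-1) * (inverse (z i) * inverse (z i))) z"
      by (cases "i = j") (auto simp: has_pd_def power2_eq_square intro!: derivative_eq_intros)
  qed
next
  case inv_h
  obtain g where g: "g \<in> coeff_fns" "\<forall>z\<in>V. has_pd j h (g z) z"
    using has_pd_h[OF assms(2)] by (rule bexE)
  have "(\<lambda>z. (-1) * (g z * (inverse (h z) * inverse (h z)))) \<in> coeff_fns"
    by (intro coeff_fns.mult coeff_fns.const coeff_fns.inv_h g(1))
  then show ?case
  proof (rule bexI[rotated], intro ballI)
    fix z assume z: "z \<in> V"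
    show "has_pd j (\<lambda>z. inverse (h z)) ((-1) * (g z * (inverse (h z) * inverse (h z)))) z"
      using g(2)[rule_format, OF z] V_nonzero[OF z] unfolding has_pd_def
      by (auto intro!: derivative_eq_intros)
  qed
next
  case (add f g)
  obtain f' where f': "f' \<in> coeff_fns" "\<forall>z\<in>V. has_pd j f (f' z) z"
    using add.IH(1) by (rule bexE)
  obtain g' where g': "g' \<in> coeff_fns" "\<forall>z\<in>V. has_pd j g (g' z) z"
    using add.IH(2) by (rule bexE)
  show ?case
    using f'(2) g'(2) by (intro bexI[OF _ coeff_fns.add[OF f'(1) g'(1)]]) (auto simp: has_pd_def intro!: derivative_intros)
next
  case (mult f g)
  obtain f' where f': "f' \<in> coeff_fns" "\<forall>z\<in>V. has_pd j f (f' z) z"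
    using mult.IH(1) by (rule bexE)
  obtain g' where g': "g' \<in> coeff_fns" "\<forall>z\<in>V. has_pd j g (g' z) z"
    using mult.IH(2) by (rule bexE)
  have "(\<lambda>z. f' z * g z + g' z * f z) \<in> coeff_fns"
    by (intro coeff_fns.add coeff_fns.mult f'(1) g'(1) mult.hyps)
  then show ?case
  proof (rule bexI[rotated], intro ballI)
    fix z assume z: "z \<in> V"
    show "has_pd j (\<lambda>z. f z * g z) (f' z * g z + g' z * f z) z"
      using f'(2)[rule_format, OF z] g'(2)[rule_format, OF z] unfolding has_pd_def
      by (auto intro!: derivative_eq_intros)
  qed
qed

lemma smooth_Phi:
  assumes "\<And>z. z \<in> V \<Longrightarrow> f z = Phi z"
  shows "smooth_fn 6 V f"
proof (rule smooth_fnI[OF open_V continuous_on_coeff_fns has_pd_coeff_fns])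
  show "(\<lambda>z. (h z + z 3) * (h z + z 3) * inverse (h z)) \<in> coeff_fns"
    by (intro coeff_fns.intros) auto
qed (use assms in \<open>auto simp: Phi_def power2_eq_square divide_inverse\<close>)

definition Phi_sq :: "(nat \<Rightarrow> real) \<Rightarrow> real" where
  "Phi_sq z = (h z + z 3) ^ 4 / h z ^ 2"

text \<open>The fibre gradient of F^2, with 0, 1, 2 standing for u, a, b. The lists of components
  below use the same numbering.\<close>

definition Phi_sq' :: "nat \<Rightarrow> (nat \<Rightarrow> real) \<Rightarrow> real" where
  "Phi_sq' j z = (h z + z 3) ^ 3 / h z ^ 3 *
     [2 * (3 * h z - z 3), (h z - z 3)\<^sup>2 / z 4, (h z - z 3)\<^sup>2 / z 5] ! j"

lemma less_3_cases:
  assumes "i < (3::nat)"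
  obtains "i = 0" | "i = Suc 0" | "i = 2"
  using assms by linarith

lemma has_pd_Phi_sq:
  assumes "z \<in> V"
  shows "has_pd 0 Phi_sq (2 * (h z + z 3) ^ 3 * (h z - z 3)\<^sup>2 / h z ^ 3) z"
    and "has_pd (Suc 0) Phi_sq 0 z" and "has_pd 2 Phi_sq 0 z"
    and "j < 3 \<Longrightarrow> has_pd (3 + j) Phi_sq (Phi_sq' j z) z"
proof -
  note nz = V_nonzero[OF assms]
  show "has_pd 0 Phi_sq (2 * (h z + z 3) ^ 3 * (h z - z 3)\<^sup>2 / h z ^ 3) z"
    using assms nz unfolding has_pd_def Phi_sq_def Phi_sq'_def
    by (auto intro!: derivative_eq_intros simp: divide_simps)
      (simp add: algebra_simps power_numeral_reduce)
  show "has_pd (Suc 0) Phi_sq 0 z" "has_pd 2 Phi_sq 0 z"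
    using assms nz unfolding has_pd_def Phi_sq_def by (auto intro!: derivative_eq_intros)
  show "has_pd (3 + j) Phi_sq (Phi_sq' j z) z" if "j < 3"
    by (rule less_3_cases[OF that]; use assms nz in \<open>auto intro!: derivative_eq_intros simp: has_pd_def Phi_sq_def Phi_sq'_def divide_simps\<close>)
      (simp_all add: algebra_simps power_numeral_reduce)
qed

section \<open>The metric\<close>

definition metric_expr :: "nat \<Rightarrow> nat \<Rightarrow> (nat \<Rightarrow> real) \<Rightarrow> real" where
  "metric_expr i j z = (let u = z 3; a = z 4; b = z 5; w = h z - u in (h z + u)\<^sup>2 / h z ^ 4 *
     [[11 * (h z)\<^sup>2 - 10 * h z * u + 3 * u\<^sup>2, 3 * w ^ 3 / (2 * a), 3 * w ^ 3 / (2 * b)],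
      [3 * w ^ 3 / (2 * a), - 3 * u * w ^ 3 / (4 * a\<^sup>2),
       w\<^sup>2 * (2 * (h z)\<^sup>2 - h z * u + 3 * u\<^sup>2) / (4 * a * b)],
      [3 * w ^ 3 / (2 * b), w\<^sup>2 * (2 * (h z)\<^sup>2 - h z * u + 3 * u\<^sup>2) / (4 * a * b),
       - 3 * u * w ^ 3 / (4 * b\<^sup>2)]] ! i ! j)"

text \<open>An explicit candidate for the inverse metric, justified by multiplying out in
  \<open>metric_expr_mult_inv\<close>.\<close>

definition inv_metric_expr :: "nat \<Rightarrow> nat \<Rightarrow> (nat \<Rightarrow> real) \<Rightarrow> real" where
  "inv_metric_expr i j z = (let u = z 3; a = z 4; b = z 5; w = h z - u in (h z)\<^sup>2 / (2 * (h z + u) ^ 4) *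
     [[(h z)\<^sup>2 - 2 * h z * u + 3 * u\<^sup>2, - 3 * w * a, - 3 * w * b],
      [- 3 * w * a, 3 * a\<^sup>2 * (3 * h z - u) / w,
       a * b * (13 * (h z)\<^sup>2 - 8 * h z * u + 3 * u\<^sup>2) / w\<^sup>2],
      [- 3 * w * b, a * b * (13 * (h z)\<^sup>2 - 8 * h z * u + 3 * u\<^sup>2) / w\<^sup>2,
       3 * b\<^sup>2 * (3 * h z - u) / w]] ! i ! j)"

text \<open>The second derivatives of F^2 that occur in the metric and the spray. The factor 2
  offsets the 1/2 in g_ij; derivatives in x and x' vanish because the base point enters only through
  t.\<close>

lemma has_pd_Phi_sq':
  assumes "z \<in> V"
  shows "i < 3 \<Longrightarrow> j < 3 \<Longrightarrow> has_pd (3 + i) (Phi_sq' j) (2 * metric_expr i j z) z"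
    and "j < 3 \<Longrightarrow> has_pd 0 (Phi_sq' j) ((h z - z 3)\<^sup>2 * (h z + z 3)\<^sup>2 / h z ^ 4 *
           [6 * (h z - z 3), (2 * (h z)\<^sup>2 - h z * z 3 + 3 * (z 3)\<^sup>2) / z 4,
            (2 * (h z)\<^sup>2 - h z * z 3 + 3 * (z 3)\<^sup>2) / z 5] ! j) z"
    and "j < 3 \<Longrightarrow> has_pd (Suc 0) (Phi_sq' j) 0 z"
    and "j < 3 \<Longrightarrow> has_pd 2 (Phi_sq' j) 0 z"
proof -
  note nz = V_nonzero[OF assms]
  show "has_pd (3 + i) (Phi_sq' j) (2 * metric_expr i j z) z" if "i < 3" "j < 3"
    by (rule less_3_cases[OF that(1)]; rule less_3_cases[OF that(2)];
        use assms nz in \<open>auto intro!: derivative_eq_intros simp: has_pd_def Phi_sq'_def metric_expr_def Let_def divide_simps\<close>)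
      (simp_all add: algebra_simps power_numeral_reduce)
  show "has_pd 0 (Phi_sq' j) ((h z - z 3)\<^sup>2 * (h z + z 3)\<^sup>2 / h z ^ 4 *
           [6 * (h z - z 3), (2 * (h z)\<^sup>2 - h z * z 3 + 3 * (z 3)\<^sup>2) / z 4,
            (2 * (h z)\<^sup>2 - h z * z 3 + 3 * (z 3)\<^sup>2) / z 5] ! j) z" if "j < 3"
    by (rule less_3_cases[OF that];
        use assms nz in \<open>auto intro!: derivative_eq_intros simp: has_pd_def Phi_sq'_def divide_simps\<close>)
      (simp_all add: algebra_simps power_numeral_reduce)
  show "has_pd (Suc 0) (Phi_sq' j) 0 z" "has_pd 2 (Phi_sq' j) 0 z" if "j < 3"
    by (rule less_3_cases[OF that];
        use assms nz in \<open>auto intro!: derivative_eq_intros simp: has_pd_def Phi_sq'_def\<close>)+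
qed

lemma sum_lessThan_3: "sum F {..<3} = F 0 + F (Suc 0) + F (2 :: nat)" for F :: "nat \<Rightarrow> real"
  by (simp add: numeral_3_eq_3 numeral_2_eq_2)

text \<open>One multiplication yields both nondegeneracy and the inverse of g, with no determinant
  to expand.\<close>

lemma metric_expr_mult_inv:
  assumes "z \<in> V" "i < 3" "j < 3"
  shows "(\<Sum>k<3. metric_expr i k z * inv_metric_expr k j z) = of_bool (i = j)"
proof -
  note nz = V_nonzero[OF assms(1)]
  show ?thesis
    by (rule less_3_cases[OF assms(2)]; rule less_3_cases[OF assms(3)];
        use nz in \<open>simp add: sum_lessThan_3 metric_expr_def inv_metric_expr_def Let_def divide_simps\<close>)
      (simp_all add: algebra_simps power_numeral_reduce)
qed

section \<open>The spray and its derivatives\<close>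

text \<open>Since h = W + u, the factor \<open>3 * h z + z 3\<close> is 3 W + 4 u; this is the spray
  announced at the start for c = 3, k = 2.\<close>

definition spray_expr :: "nat \<Rightarrow> (nat \<Rightarrow> real) \<Rightarrow> real" where
  "spray_expr m z = [- (h z - z 3)\<^sup>2, (3 * h z + z 3) * z 4, (3 * h z + z 3) * z 5] ! m / 4"

definition spray_d1 :: "nat \<Rightarrow> nat \<Rightarrow> (nat \<Rightarrow> real) \<Rightarrow> real" where
  "spray_d1 m j z = (let u = z 3; a = z 4; b = z 5; w = h z - u in
     [[0, - w\<^sup>2 / (4 * a), - w\<^sup>2 / (4 * b)],
      [a, (9 * h z - u) / 8, 3 * a * w / (8 * b)],
      [b, 3 * b * w / (8 * a), (9 * h z - u) / 8]] ! m ! j)"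

definition spray_d2 :: "nat \<Rightarrow> nat \<Rightarrow> nat \<Rightarrow> (nat \<Rightarrow> real) \<Rightarrow> real" where
  "spray_d2 m j k z = (let u = z 3; a = z 4; b = z 5; w = h z - u in
     [[[0, 0, 0], [0, 0, - w\<^sup>2 / (4 * a * b)], [0, - w\<^sup>2 / (4 * a * b), 0]],
      [[0, 1, 0], [1, 9 * w / (16 * a), 9 * w / (16 * b)],
       [0, 9 * w / (16 * b), - 3 * a * w / (16 * b\<^sup>2)]],
      [[0, 0, 1], [0, - 3 * b * w / (16 * a\<^sup>2), 9 * w / (16 * a)],
       [1, 9 * w / (16 * a), 9 * w / (16 * b)]]] ! m ! j ! k)"

text \<open>The Berwald tensor. G^0 and the terms u y^m are quadratic and W does not depend on u,
  whence the zeros. The lists hold the derivatives of 3/4 W y^m along aaa, aab, abb, bbb: for i, j,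
  k in {1, 2} the index i + j + k - 3 counts the directions b.\<close>

definition spray_d3 :: "nat \<Rightarrow> nat \<Rightarrow> nat \<Rightarrow> nat \<Rightarrow> (nat \<Rightarrow> real) \<Rightarrow> real" where
  "spray_d3 m i j k z = (let a = z 4; b = z 5; c = 9 * (h z - z 3) / 32 in
     if m = 0 \<or> i = 0 \<or> j = 0 \<or> k = 0 then 0
     else [[- c / a\<^sup>2, c / (a * b), - c / b\<^sup>2, c * a / b ^ 3],
           [c * b / a ^ 3, - c / a\<^sup>2, c / (a * b), - c / b\<^sup>2]] ! (m - 1) ! (i + j + k - 3))"

lemma has_pd_spray_expr:
  assumes "z \<in> V" "m < 3" "j < 3"
  shows "has_pd (3 + j) (spray_expr m) (spray_d1 m j z) z"
  by (rule less_3_cases[OF assms(2)]; rule less_3_cases[OF assms(3)];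
      use assms(1) V_nonzero[OF assms(1)] in
        \<open>auto intro!: derivative_eq_intros simp: has_pd_def spray_expr_def spray_d1_def Let_def divide_simps\<close>)
    (simp_all add: algebra_simps power_numeral_reduce)

lemma has_pd_spray_d1:
  assumes "z \<in> V" "m < 3" "j < 3" "k < 3"
  shows "has_pd (3 + j) (spray_d1 m k) (spray_d2 m j k z) z"
  by (rule less_3_cases[OF assms(2)]; rule less_3_cases[OF assms(3)]; rule less_3_cases[OF assms(4)];
      use assms(1) V_nonzero[OF assms(1)] in
        \<open>auto intro!: derivative_eq_intros simp: has_pd_def spray_d1_def spray_d2_def Let_def divide_simps\<close>)
    (simp_all add: algebra_simps power_numeral_reduce)

lemma has_pd_spray_d2:
  assumes "z \<in> V" "m < 3" "i < 3" "j < 3" "k < 3"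
  shows "has_pd (3 + i) (spray_d2 m j k) (spray_d3 m i j k z) z"
  by (rule less_3_cases[OF assms(2)]; rule less_3_cases[OF assms(3)];
      rule less_3_cases[OF assms(4)]; rule less_3_cases[OF assms(5)];
      use assms(1) V_nonzero[OF assms(1)] in
        \<open>auto intro!: derivative_eq_intros simp: has_pd_def spray_d2_def spray_d3_def Let_def divide_simps\<close>)
    (simp_all add: algebra_simps power_numeral_reduce)

section \<open>The Landsberg tensor and the hv-curvature\<close>

definition Phi' :: "nat \<Rightarrow> (nat \<Rightarrow> real) \<Rightarrow> real" where
  "Phi' m z = (h z + z 3) / (h z)\<^sup>2 *
     [3 * h z - z 3, (h z - z 3)\<^sup>2 / (2 * z 4), (h z - z 3)\<^sup>2 / (2 * z 5)] ! m"

lemma has_pd_Phi: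
  assumes "z \<in> V" "m < 3"
  shows "has_pd (3 + m) Phi (Phi' m z) z"
  by (rule less_3_cases[OF assms(2)];
      use assms(1) V_nonzero[OF assms(1)] in
        \<open>auto intro!: derivative_eq_intros simp: has_pd_def Phi_def Phi'_def divide_simps\<close>)
    (simp_all add: algebra_simps power_numeral_reduce)

text \<open>Only m = 1, 2 contribute. The corresponding entries of \<open>Phi'\<close> are in the
  ratio 1/a : 1/b, while the first list of \<open>spray_d3\<close> divided by a is minus the second
  divided by b, so the two terms cancel.\<close>

lemma Phi'_spray_d3:
  assumes "z \<in> V" "i < 3" "j < 3" "k < 3"
  shows "(\<Sum>m<3. Phi' m z * spray_d3 m i j k z) = 0"
  by (rule less_3_cases[OF assms(2)]; rule less_3_cases[OF assms(3)]; rule less_3_cases[OF assms(4)];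
      use V_nonzero[OF assms(1)] in
        \<open>simp add: sum_lessThan_3 Phi'_def spray_d3_def Let_def divide_simps\<close>)
    (simp_all add: algebra_simps power_numeral_reduce)

section \<open>Derivatives of the metric entering the Chern connection\<close>

lemma metric_expr_commute: "i < 3 \<Longrightarrow> j < 3 \<Longrightarrow> metric_expr i j = metric_expr j i"
  by (erule less_3_cases; erule less_3_cases) (simp_all add: metric_expr_def fun_eq_iff)

text \<open>Up to the symmetry of g, these are the derivatives occurring in the Chern coefficient
  with all three indices 1; the fibre derivatives come from the horizontal derivatives. Some
  coincide, because fibre derivatives of g are half the third fibre derivatives of F^2.\<close>

lemma has_pd_metric_expr:
  assumes "z \<in> V"
  shows "has_pd (Suc 0) (metric_expr 0 (Suc 0)) 0 z" "has_pd (Suc 0) (metric_expr (Suc 0) (Suc 0)) 0 z"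
    "has_pd (Suc 0) (metric_expr (Suc 0) 2) 0 z" "has_pd 2 (metric_expr (Suc 0) (Suc 0)) 0 z"
    and "has_pd 0 (metric_expr (Suc 0) (Suc 0))
      (- 3 * z 3 * (h z - z 3) ^ 3 * (h z + z 3) * ((h z)\<^sup>2 + z 3 * h z + 4 * (z 3)\<^sup>2) /
        (4 * (z 4)\<^sup>2 * h z ^ 5)) z" (is ?t)
    and "has_pd 3 (metric_expr 0 (Suc 0)) (- 6 * z 3 * (h z - z 3) ^ 3 * (h z + z 3) / (z 4 * h z ^ 5)) z" (is ?uu)
    and "has_pd 4 (metric_expr 0 (Suc 0))
      (3 * (h z - z 3) ^ 3 * (h z + z 3) * (4 * (z 3)\<^sup>2 - z 3 * h z - (h z)\<^sup>2) /
        (4 * (z 4)\<^sup>2 * h z ^ 5)) z" (is ?ua)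
    and "has_pd 5 (metric_expr 0 (Suc 0))
      (3 * (h z - z 3) ^ 3 * (h z + z 3) * ((h z)\<^sup>2 + z 3 * h z + 4 * (z 3)\<^sup>2) /
        (4 * z 4 * z 5 * h z ^ 5)) z" (is ?ub)
    and "has_pd 3 (metric_expr (Suc 0) (Suc 0))
      (3 * (h z - z 3) ^ 3 * (h z + z 3) * (4 * (z 3)\<^sup>2 - z 3 * h z - (h z)\<^sup>2) /
        (4 * (z 4)\<^sup>2 * h z ^ 5)) z" (is ?au)
    and "has_pd 4 (metric_expr (Suc 0) (Suc 0))
      (3 * z 3 * (h z - z 3) ^ 3 * (h z + z 3) * (3 * (h z)\<^sup>2 + 3 * z 3 * h z - 4 * (z 3)\<^sup>2) /
        (8 * z 4 ^ 3 * h z ^ 5)) z" (is ?aa)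
    and "has_pd 5 (metric_expr (Suc 0) (Suc 0))
      (- 3 * z 3 * (h z - z 3) ^ 3 * (h z + z 3) * ((h z)\<^sup>2 + z 3 * h z + 4 * (z 3)\<^sup>2) /
        (8 * (z 4)\<^sup>2 * z 5 * h z ^ 5)) z" (is ?ab)
    and "has_pd 3 (metric_expr (Suc 0) 2)
      (3 * (h z - z 3) ^ 3 * (h z + z 3) * ((h z)\<^sup>2 + z 3 * h z + 4 * (z 3)\<^sup>2) /
        (4 * z 4 * z 5 * h z ^ 5)) z" (is ?bu)
    and "has_pd 4 (metric_expr (Suc 0) 2)
      (- 3 * z 3 * (h z - z 3) ^ 3 * (h z + z 3) * ((h z)\<^sup>2 + z 3 * h z + 4 * (z 3)\<^sup>2) /
        (8 * (z 4)\<^sup>2 * z 5 * h z ^ 5)) z" (is ?ba)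
    and "has_pd 5 (metric_expr (Suc 0) 2)
      (- 3 * z 3 * (h z - z 3) ^ 3 * (h z + z 3) * ((h z)\<^sup>2 + z 3 * h z + 4 * (z 3)\<^sup>2) /
        (8 * z 4 * (z 5)\<^sup>2 * h z ^ 5)) z" (is ?bb)
proof -
  note nz = V_nonzero[OF assms]
  show "has_pd (Suc 0) (metric_expr 0 (Suc 0)) 0 z" "has_pd (Suc 0) (metric_expr (Suc 0) (Suc 0)) 0 z"
    "has_pd (Suc 0) (metric_expr (Suc 0) 2) 0 z" "has_pd 2 (metric_expr (Suc 0) (Suc 0)) 0 z"
    using assms nz by (auto intro!: derivative_eq_intros simp: has_pd_def metric_expr_def Let_def)
  show ?t ?uu ?ua ?ub
    using assms nz
    by (auto intro!: derivative_eq_intros simp: has_pd_def metric_expr_def Let_def divide_simps)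
      (simp_all add: algebra_simps power_numeral_reduce)
  show ?au ?aa ?ab
    using assms nz
    by (auto intro!: derivative_eq_intros simp: has_pd_def metric_expr_def Let_def divide_simps)
      (simp_all add: algebra_simps power_numeral_reduce)
  show ?bu ?ba ?bb
    using assms nz
    by (auto intro!: derivative_eq_intros simp: has_pd_def metric_expr_def Let_def divide_simps)
      (simp_all add: algebra_simps power_numeral_reduce)
qed

section \<open>Tensors of a function agreeing with \<open>Phi\<close> on \<open>V\<close>\<close>

lemma pd_V:
  "(\<And>w. w \<in> V \<Longrightarrow> F w = G w) \<Longrightarrow> has_pd i G d z \<Longrightarrow> z \<in> V \<Longrightarrow> i < 6 \<Longrightarrow> pd i F z = d"
  by (rule pd_eqI[OF open_V])

text \<open>\<open>f\<close> will be the coordinate expression of \<open>F\<^sub>0\<close>, which is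
  compared with \<open>Phi\<close> on \<open>V\<close> only. As \<open>V\<close> is open, this
  determines all its derivatives there.\<close>

context
  fixes f :: "(nat \<Rightarrow> real) \<Rightarrow> real"
  assumes f: "\<And>z. z \<in> V \<Longrightarrow> f z = Phi z"
begin

lemma square_eq_Phi_sq: "z \<in> V \<Longrightarrow> (f z)\<^sup>2 = Phi_sq z"
  by (simp add: f Phi_def Phi_sq_def power_divide flip: power_mult)

lemma pd_square: "z \<in> V \<Longrightarrow> j < 3 \<Longrightarrow> pd (3 + j) (\<lambda>w. (f w)\<^sup>2) z = Phi_sq' j z"
  by (rule pd_V[OF square_eq_Phi_sq has_pd_Phi_sq(4)]) auto

lemma metric_mat_eq:
  assumes "z \<in> V"
  shows "metric_mat 3 f z = mat 3 3 (\<lambda>(i, j). metric_expr i j z)"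
proof (rule eq_matI)
  fix i j assume "i < dim_row (mat 3 3 (\<lambda>(i, j). metric_expr i j z))" "j < dim_col (mat 3 3 (\<lambda>(i, j). metric_expr i j z))"
  then have ij: "i < 3" "j < 3" by simp_all
  have "pd (3 + i) (pd (3 + j) (\<lambda>w. (f w)\<^sup>2)) z = 2 * metric_expr i j z"
    by (rule pd_V[OF pd_square has_pd_Phi_sq'(1)]) (use assms ij in auto)
  then show "metric_mat 3 f z $$ (i, j) = mat 3 3 (\<lambda>(i, j). metric_expr i j z) $$ (i, j)"
    using ij by (simp add: metric_mat_def)
qed (simp_all add: metric_mat_def)

lemma metric_eq: "z \<in> V \<Longrightarrow> i < 3 \<Longrightarrow> j < 3 \<Longrightarrow> metric 3 f i j z = metric_expr i j z"
  by (simp add: metric_def metric_mat_eq)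

lemma metric_mat_mult:
  assumes "z \<in> V"
  shows "metric_mat 3 f z * mat 3 3 (\<lambda>(i, j). inv_metric_expr i j z) = 1\<^sub>m 3"
proof (rule eq_matI)
  fix i j assume "i < dim_row (1\<^sub>m 3 :: real mat)" "j < dim_col (1\<^sub>m 3 :: real mat)"
  then show "(metric_mat 3 f z * mat 3 3 (\<lambda>(i, j). inv_metric_expr i j z)) $$ (i, j) = 1\<^sub>m 3 $$ (i, j)"
    using metric_expr_mult_inv[OF assms, of i j]
    by (simp add: metric_mat_eq[OF assms] scalar_prod_def atLeast0LessThan)
qed (simp_all add: metric_mat_def)

lemma det_metric_mat:
  assumes "z \<in> V"
  shows "Determinant.det (metric_mat 3 f z) \<noteq> 0"
proof
  assume "Determinant.det (metric_mat 3 f z) = 0"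
  \<comment> \<open>By multiplicativity the two determinants have product det 1 = 1, so neither is
    0.\<close>
  moreover have "Determinant.det (metric_mat 3 f z * mat 3 3 (\<lambda>(i, j). inv_metric_expr i j z)) =
      Determinant.det (metric_mat 3 f z) * Determinant.det (mat 3 3 (\<lambda>(i, j). inv_metric_expr i j z))"
    by (rule Determinant.det_mult) (auto simp: metric_mat_def)
  ultimately show False
    by (simp add: metric_mat_mult[OF assms])
qed

lemma inv_metric_eq:
  assumes "z \<in> V" "i < 3" "j < 3"
  shows "inv_metric 3 f i j z = inv_metric_expr i j z"
proof -
  let ?A = "metric_mat 3 f z" and ?B = "mat 3 3 (\<lambda>(i, j). inv_metric_expr i j z)"
  have A: "?A \<in> carrier_mat 3 3" and B: "?B \<in> carrier_mat 3 3"
    by (auto simp: metric_mat_def)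
  note AB = metric_mat_mult[OF assms(1)]
  have BA: "?B * ?A = 1\<^sub>m 3"
    by (rule mat_mult_left_right_inverse[OF A B AB])
  \<comment> \<open>\<open>inv_metric\<close> applies \<open>the\<close> to an option, so
    \<open>None\<close> must be excluded: it would mean that the matrix is not a unit of the matrix
    ring.\<close>
  obtain C where C: "mat_inverse ?A = Some C"
  proof (cases "mat_inverse ?A")
    case None
    have "?A \<in> Units (ring_mat TYPE(real) 3 ())"
      unfolding Units_def ring_mat_def using A B AB BA by auto
    with mat_inverse(1)[OF A None, of "()"] show ?thesis by blast
  qed
  then have "?A * C = 1\<^sub>m 3" "C \<in> carrier_mat 3 3"
    using mat_inverse(2)[OF A] by auto
  \<comment> \<open>Uniqueness of inverses: C = (B A) C = B (A C) = B.\<close>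
  then have "C = ?B"
    using assoc_mult_mat[OF B A, of C 3] BA right_mult_one_mat[OF B] left_mult_one_mat[of C 3 3] by simp
  then show ?thesis
    using assms by (simp add: inv_metric_def C)
qed

lemma spray_eq:
  assumes z: "z \<in> V" and m: "m < 3"
  shows "spray 3 f m z = spray_expr m z"
proof -
  have pd2: "pd k (pd (3 + l) (\<lambda>w. (f w)\<^sup>2)) z = d" if "has_pd k (Phi_sq' l) d z" "l < 3" "k < 3" for k l d
    by (rule pd_V[OF pd_square that(1)]) (use that z in auto)
  have pd1: "pd l (\<lambda>w. (f w)\<^sup>2) z = d" if "has_pd l Phi_sq d z" "l < 3" for l d
    by (rule pd_V[OF square_eq_Phi_sq that(1)]) (use that z in auto)
  \<comment> \<open>Mixed derivatives of F^2 in the base directions 0, 1, 2 in turn, instantiated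
    next at each fibre index.\<close>
  note pd0 = pd2[OF has_pd_Phi_sq'(2)[OF z]] pd2[OF has_pd_Phi_sq'(3)[OF z]] pd2[OF has_pd_Phi_sq'(4)[OF z]]
  note pd0' = pd0[of 0] pd0[of "Suc 0"] pd0[of 2]
  note pd1' = pd1[OF has_pd_Phi_sq(1)[OF z]] pd1[OF has_pd_Phi_sq(2)[OF z]] pd1[OF has_pd_Phi_sq(3)[OF z]]
  have "spray 3 f m z = 1 / 4 * (\<Sum>l<3. inv_metric_expr m l z *
     ((\<Sum>k<3. pd k (pd (3 + l) (\<lambda>w. (f w)\<^sup>2)) z * z (3 + k)) - pd l (\<lambda>w. (f w)\<^sup>2) z))"
    using z m by (simp add: spray_def inv_metric_eq)
  also have "\<dots> = spray_expr m z"
    using pd0' pd1' V_nonzero[OF z]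
    by (simp add: sum_lessThan_3)
      (rule less_3_cases[OF m];
       simp add: inv_metric_expr_def spray_expr_def Let_def divide_simps;
       simp add: algebra_simps power_numeral_reduce)
  finally show ?thesis .
qed

lemma nonlinear_connection_eq:
  "z \<in> V \<Longrightarrow> m < 3 \<Longrightarrow> j < 3 \<Longrightarrow> nonlinear_connection 3 f m j z = spray_d1 m j z"
  unfolding nonlinear_connection_def by (rule pd_V[OF spray_eq has_pd_spray_expr]) auto

lemma berwald_tensor_eq:
  assumes "m < 3" "i < 3" "j < 3" "k < 3" "z \<in> V"
  shows "berwald_tensor 3 f m i j k z = spray_d3 m i j k z"
proof -
  \<comment> \<open>Each equation is established at every point of \<open>V\<close>, since the next
    derivative needs agreement on an open set.\<close>
  have "pd (3 + k) (spray 3 f m) w = spray_d1 m k w" if "w \<in> V" for w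
    by (rule pd_V[OF spray_eq has_pd_spray_expr]) (use assms that in auto)
  then have "pd (3 + j) (pd (3 + k) (spray 3 f m)) w = spray_d2 m j k w" if "w \<in> V" for w
    by (rule pd_V[OF _ has_pd_spray_d1]) (use assms that in auto)
  then have "pd (3 + i) (pd (3 + j) (pd (3 + k) (spray 3 f m))) z = spray_d3 m i j k z"
    by (rule pd_V[OF _ has_pd_spray_d2]) (use assms in auto)
  then show ?thesis by (simp add: berwald_tensor_def)
qed

lemma landsberg_tensor_eq_0:
  assumes "z \<in> V" "i < 3" "j < 3" "k < 3"
  shows "landsberg_tensor 3 f i j k z = 0"
proof -
  have "pd (3 + m) f z = Phi' m z" if "m < 3" for m
    by (rule pd_V[OF f has_pd_Phi]) (use assms that in auto)
  then show ?thesis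
    using Phi'_spray_d3[OF assms] assms by (simp add: landsberg_tensor_def berwald_tensor_eq)
qed

text \<open>The value equals \<open>spray_d2 1 1 1 z\<close>, as expected: where the Landsberg
  tensor vanishes, the Chern and Berwald connections coincide. Here it is computed directly from the
  metric.\<close>

lemma chern_coeff_eq:
  assumes z: "z \<in> V"
  shows "chern_coeff 3 f 1 1 1 z = 9 * (h z - z 3) / (16 * z 4)"
proof -
  have pd_metric: "pd k (metric 3 f i j) z = d" if "has_pd k (metric_expr i j) d z" "i < 3" "j < 3" "k < 6" for i j k d
    by (rule pd_V[OF metric_eq that(1)]) (use that z in auto)
  \<comment> \<open>The derivatives of g_01 and g_12 are supplied in both index orders, as the Chern
    formula contains both.\<close>
  note dg = has_pd_metric_expr[OF z, THEN pd_metric, simplified]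
    has_pd_metric_expr[OF z, unfolded metric_expr_commute[of 0 "Suc 0", simplified] metric_expr_commute[of "Suc 0" 2, simplified],
      THEN pd_metric, simplified]
  show ?thesis
    using V_nonzero[OF z] z
    by (simp add: chern_coeff_def horizontal_deriv_def sum_lessThan_3 inv_metric_eq
        nonlinear_connection_eq dg inv_metric_expr_def spray_d1_def Let_def divide_simps)
      (simp add: algebra_simps power_numeral_reduce)
qed

text \<open>Differentiating 9 W / (16 a) along b acts on W alone and gives 9 W / (32 a b), the aab
  component of the Berwald tensor, which is positive on \<open>V\<close>.\<close>

lemma chern_hv_curvature_neq_0:
  assumes z: "z \<in> V"
  shows "chern_hv_curvature 3 f 1 1 1 2 z \<noteq> 0"
proof -
  have "has_pd 5 (\<lambda>z. 9 * (h z - z 3) / (16 * z 4)) (9 * (h z - z 3) / (32 * z 4 * z 5)) z"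
    using z V_nonzero[OF z] by (auto intro!: derivative_eq_intros simp: has_pd_def divide_simps)
  then have "pd 5 (chern_coeff 3 f 1 1 1) z = 9 * (h z - z 3) / (32 * z 4 * z 5)"
    by (rule pd_V[rotated]) (use z chern_coeff_eq in auto)
  then show ?thesis
    using V_nonzero[OF z] by (simp add: chern_hv_curvature_def)
qed

end

section \<open>The example\<close>

definition A\<^sub>0 :: "(nat \<Rightarrow> real) chart set" where
  "A\<^sub>0 = {std_chart 3}"

definition U\<^sub>0 :: "((nat \<Rightarrow> real) \<times> (nat \<Rightarrow> real) tvec) set" where
  "U\<^sub>0 = bundle_point 3 ` V"

definition F\<^sub>0 :: "(nat \<Rightarrow> real) \<times> (nat \<Rightarrow> real) tvec \<Rightarrow> real" where
  "F\<^sub>0 u = Phi (tcoords 3 (std_chart 3) u)"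

lemma F\<^sub>0_bundle_point: "z \<in> topspace (Euclidean_space 6) \<Longrightarrow> F\<^sub>0 (bundle_point 3 z) = Phi z"
  using tcoords_bundle_point[of z 3] by (simp add: F\<^sub>0_def)

lemma coord_dom_U\<^sub>0: "coord_dom 3 A\<^sub>0 U\<^sub>0 (std_chart 3) = V"
  unfolding A\<^sub>0_def U\<^sub>0_def by (rule coord_dom_std) (auto simp: V_def)

lemma local_rep_F\<^sub>0: "z \<in> V \<Longrightarrow> local_rep 3 A\<^sub>0 (std_chart 3) F\<^sub>0 z = Phi z"
  using V_D(1) by (simp add: A\<^sub>0_def local_rep_std F\<^sub>0_bundle_point)

text \<open>For r > 0 the square root of r^2 a b is r times that of a b; homogeneity of
  \<open>V\<close> and \<open>Phi\<close> follows from this.\<close>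

lemma h_scale_fibre: "r > 0 \<Longrightarrow> h (scale_fibre 3 r z) = r * h z"
proof -
  assume "r > 0"
  then have "sqrt (r * z 4 * (r * z 5)) = r * sqrt (z 4 * z 5)"
    by (simp add: real_sqrt_mult algebra_simps flip: power2_eq_square)
  then show ?thesis
    by (simp add: h_def W_def scale_fibre_def algebra_simps)
qed

lemma scale_fibre_V:
  assumes "z \<in> V" "r > 0"
  shows "scale_fibre 3 r z \<in> V" "Phi (scale_fibre 3 r z) = r * Phi z"
proof -
  have *: "scale_fibre 3 r z 3 = r * z 3" by (simp add: scale_fibre_def)
  have "h (scale_fibre 3 r z) + scale_fibre 3 r z 3 = r * (h z + z 3)"
    by (simp add: * h_scale_fibre[OF assms(2)] algebra_simps)
  then show "scale_fibre 3 r z \<in> V" "Phi (scale_fibre 3 r z) = r * Phi z"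
    using V_D[OF assms(1)] assms(2)
    by (auto simp: V_def Phi_def scale_fibre_def topspace_Euclidean_space h_scale_fibre[OF assms(2)]
        power_mult_distrib power2_eq_square)
qed

lemma finsler_function_F\<^sub>0: "finsler_function 3 (Euclidean_space 3) A\<^sub>0 U\<^sub>0 F\<^sub>0"
  unfolding finsler_function_def
proof (intro conjI ballI allI impI)
  show "U\<^sub>0 \<subseteq> slit_tangent_bundle 3 (Euclidean_space 3) A\<^sub>0"
    unfolding A\<^sub>0_def slit_tangent_bundle_std U\<^sub>0_def
    by (intro image_mono) (auto simp: V_def intro!: exI[of _ 1])
next
  fix c assume c: "c \<in> A\<^sub>0"
  then have c: "c = std_chart 3" by (simp add: A\<^sub>0_def)
  show "openin (Euclidean_space (2 * 3)) (coord_dom 3 A\<^sub>0 U\<^sub>0 c)"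
    using open_V by (simp add: c coord_dom_U\<^sub>0)
  show "smooth_fn (2 * 3) (coord_dom 3 A\<^sub>0 U\<^sub>0 c) (local_rep 3 A\<^sub>0 c F\<^sub>0)"
    using smooth_Phi[OF local_rep_F\<^sub>0] by (simp add: c coord_dom_U\<^sub>0)
  fix z assume "z \<in> coord_dom 3 A\<^sub>0 U\<^sub>0 c"
  then show "Determinant.det (metric_mat 3 (local_rep 3 A\<^sub>0 c F\<^sub>0) z) \<noteq> 0"
    using det_metric_mat[OF local_rep_F\<^sub>0] by (simp add: c coord_dom_U\<^sub>0)
next
  fix u assume "u \<in> U\<^sub>0"
  then obtain z where z: "z \<in> V" "u = bundle_point 3 z"
    by (auto simp: U\<^sub>0_def)
  have Phi: "F\<^sub>0 (bundle_point 3 w) = Phi w" if "w \<in> V" for w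
    by (rule F\<^sub>0_bundle_point) (rule V_D(1)[OF that])
  show "F\<^sub>0 u > 0"
    using V_D[OF z(1)] by (simp add: z(2) Phi[OF z(1)] Phi_def)
  have scale: "(fst u, \<lambda>c i. r * snd u c i) = bundle_point 3 (scale_fibre 3 r z)" for r
    unfolding z(2) by (rule bundle_point_scale_fibre)
  show "case u of (p, v) \<Rightarrow> \<forall>r>0. (p, \<lambda>c i. r * v c i) \<in> U\<^sub>0"
    using scale scale_fibre_V(1)[OF z(1)] by (auto simp: split_beta U\<^sub>0_def)
  show "case u of (p, v) \<Rightarrow> \<forall>r>0. F\<^sub>0 (p, \<lambda>c i. r * v c i) = r * F\<^sub>0 (p, v)"
    using scale scale_fibre_V[OF z(1)] Phi z by (simp add: split_beta)
qed

lemma no_extension_F\<^sub>0: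
  assumes "finsler_function 3 (Euclidean_space 3) A\<^sub>0
      (slit_tangent_bundle 3 (Euclidean_space 3) A\<^sub>0) F"
  shows "\<exists>u\<in>U\<^sub>0. F u \<noteq> F\<^sub>0 u"
proof (rule ccontr)
  assume "\<not> (\<exists>u\<in>U\<^sub>0. F u \<noteq> F\<^sub>0 u)"
  then have eq: "F (bundle_point 3 w) = Phi w" if "w \<in> V" for w
    using that V_D(1) by (simp add: U\<^sub>0_def F\<^sub>0_bundle_point)
  \<comment> \<open>Over the origin, a = b = 1 gives W = 1, and u = -1/2 makes W + 2 u = 0: a
    nonzero vector on the boundary of \<open>V\<close>.\<close>
  define z :: "nat \<Rightarrow> real" where "z i = (if i = 3 then - 1 / 2 else if i \<in> {4, 5} then 1 else 0)" for i
  define Z where "Z = {z \<in> topspace (Euclidean_space (2 * 3)). \<exists>i<3. z (3 + i) \<noteq> 0}"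
  let ?g = "\<lambda>t. local_rep 3 A\<^sub>0 (std_chart 3) F (z(3 := t))"
  have z6: "z(3 := t) \<in> topspace (Euclidean_space (2 * 3))" for t
    by (simp add: z_def topspace_Euclidean_space)
  have g: "?g t = F (bundle_point 3 (z(3 := t)))" for t
    unfolding A\<^sub>0_def by (rule local_rep_std[OF z6])
  have zZ: "z \<in> Z"
    by (auto simp: Z_def z_def topspace_Euclidean_space intro!: exI[of _ 0])
  have slit: "slit_tangent_bundle 3 (Euclidean_space 3) A\<^sub>0 = bundle_point 3 ` Z"
    by (simp add: A\<^sub>0_def slit_tangent_bundle_std Z_def)
  have "coord_dom 3 A\<^sub>0 (bundle_point 3 ` Z) (std_chart 3) = Z"
    unfolding A\<^sub>0_def by (rule coord_dom_std) (auto simp: Z_def)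
  then have "smooth_fn (2 * 3) Z (local_rep 3 A\<^sub>0 (std_chart 3) F)"
    using assms by (auto simp: finsler_function_def A\<^sub>0_def slit[unfolded A\<^sub>0_def])
  \<comment> \<open>For the empty list of directions, \<open>smooth_fn\<close> gives
    differentiability along the u-line, hence the continuity needed for the contradiction.\<close>
  then have "?g differentiable at (z 3)"
    using zZ unfolding smooth_fn_def
    by (auto dest!: spec[of _ "[]"] bspec[of _ _ z] spec[of _ 3])
  then have "isCont ?g (z 3)"
    by (rule differentiable_imp_continuous_within)
  then have lim: "(?g \<longlongrightarrow> ?g (z 3)) (at_right (-1/2))"
    by (simp add: isCont_def z_def filterlim_at_split)
  \<comment> \<open>On the u-line through \<open>z\<close> one has W = 1 and h = 1 + t, so
    \<open>Phi\<close> becomes this quotient. The limit is taken from the right because W + 2 u > 0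
    means t > -1/2.\<close>
  have lim0: "((\<lambda>t. (2 * t + 1)\<^sup>2 / (1 + t)) \<longlongrightarrow> 0) (at_right (-1/2 :: real))"
    by (auto intro!: tendsto_eq_intros)
  have ev: "\<forall>\<^sub>F t in at_right (-1/2). ?g t = (2 * t + 1)\<^sup>2 / (1 + t)"
  proof (rule eventually_at_rightI[of "-1/2" 0])
    fix t :: real assume t: "t \<in> {-1/2<..<0}"
    have h: "h (z(3 := t)) = 1 + t"
      by (simp add: h_def W_def z_def)
    have "z(3 := t) \<in> V"
      using t z6[of t] by (auto simp: V_def h) (simp_all add: z_def)
    then show "?g t = (2 * t + 1)\<^sup>2 / (1 + t)"
      by (simp add: g eq Phi_def h)
  qed simp
  have "(?g \<longlongrightarrow> 0) (at_right (-1/2))"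
    unfolding tendsto_cong[OF ev] by (rule lim0)
  then have "?g (z 3) = 0"
    by (rule tendsto_unique[OF trivial_limit_at_right_real lim])
  then have "F (bundle_point 3 z) = 0"
    using g[of "z 3"] by simp
  \<comment> \<open>The vector is nonzero, so it lies in the domain of the extension, where
    positivity is required.\<close>
  moreover have "F (bundle_point 3 z) > 0"
    using assms zZ unfolding finsler_function_def slit by blast
  ultimately show False by simp
qed

lemma ex_V: "\<exists>z. z \<in> V"
proof
  show "(\<lambda>i. if i \<in> {4, 5} then 1 else 0) \<in> V"
    by (simp add: V_def h_def W_def topspace_Euclidean_space)
qed

theorem theorem4p9:
  shows "\<exists>(n :: nat) (X :: (nat \<Rightarrow> real) topology) (A :: (nat \<Rightarrow> real) chart set)
            (U :: ((nat \<Rightarrow> real) \<times> (nat \<Rightarrow> real) tvec) set)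
            (F :: (nat \<Rightarrow> real) \<times> (nat \<Rightarrow> real) tvec \<Rightarrow> real).
           smooth_manifold n X A \<and> nonregular_finsler_function n X A U F \<and>
           landsbergian n A U F \<and> \<not> berwaldian n A U F"
proof (intro exI conjI)
  show "smooth_manifold 3 (Euclidean_space 3) A\<^sub>0"
    unfolding A\<^sub>0_def by (rule smooth_manifold_std)
  show "nonregular_finsler_function 3 (Euclidean_space 3) A\<^sub>0 U\<^sub>0 F\<^sub>0"
    unfolding nonregular_finsler_function_def
    using finsler_function_F\<^sub>0 no_extension_F\<^sub>0 by blast
  have A\<^sub>0: "c = std_chart 3" if "c \<in> A\<^sub>0" for c
    using that by (simp add: A\<^sub>0_def)
  show "landsbergian 3 A\<^sub>0 U\<^sub>0 F\<^sub>0"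
    unfolding landsbergian_def
    using landsberg_tensor_eq_0[OF local_rep_F\<^sub>0] by (auto dest!: A\<^sub>0 simp: coord_dom_U\<^sub>0)
  \<comment> \<open>The curvature component is nonzero throughout \<open>V\<close>, so any point of
    \<open>V\<close> refutes the Berwald condition.\<close>
  obtain z where z: "z \<in> V"
    using ex_V by blast
  have "std_chart 3 \<in> A\<^sub>0"
    by (simp add: A\<^sub>0_def)
  moreover have "z \<in> coord_dom 3 A\<^sub>0 U\<^sub>0 (std_chart 3)"
    using z by (simp add: coord_dom_U\<^sub>0)
  moreover have "(1 :: nat) < 3" "(2 :: nat) < 3"
    by simp_all
  ultimately show "\<not> berwaldian 3 A\<^sub>0 U\<^sub>0 F\<^sub>0"
    unfolding berwaldian_def
    using chern_hv_curvature_neq_0[OF local_rep_F\<^sub>0 z] by blast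
qed

end
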